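(* Let $m\geq 2$, let $f:\mathbb{C}[x_1,\ldots,x_m]\to\mathbb{C}[x_1,\ldots,x_m]$ be a $\mathbb{C}$-algebra endomorphism, put $r_i:=f(x_i)$ for $1\leq i\leq m$, and assume $\operatorname{Jac}(r_1,\ldots,r_m)\in\mathbb{C}^*$. If there exist integers $n_1,\ldots,n_{m-1}\geq 1$, elements $a_1,\ldots,a_{m-1}\in\mathbb{C}(r_1,\ldots,r_m)^*$ and $b_1,\ldots,b_{m-1}\in\mathbb{C}(r_1,\ldots,r_m)$ such that for each $1\leq j\leq m-1$ one has $(a_jx_j+b_j)^{n_j}\in\mathbb{C}(r_1,\ldots,r_m)$, then $f$ is invertible.
   Context: $\mathbb{C}[x_1,\ldots,x_m]$ is the polynomial ring in $m$ variables over $\mathbb{C}$ and $\mathbb{C}(x_1,\ldots,x_m)$ its field of fractions. $\operatorname{Jac}(r_1,\ldots,r_m)=\det\left(\frac{\partial r_i}{\partial x_j}\right)_{1\leq i,j\leq m}$ is the Jacobian determinant. $\mathbb{C}(r_1,\ldots,r_m)$ is the subfield of $\mathbb{C}(x_1,\ldots,x_m)$ generated over $\mathbb{C}$ by $r_1,\ldots,r_m$, and $\mathbb{C}(r_1,\ldots,r_m)^*$ is its set of nonzero elements; likewise $\mathbb{C}^*=\mathbb{C}\setminus\{0\}$. "$f$ is invertible" means that $f$ is a $\mathbb{C}$-algebra automorphism of $\mathbb{C}[x_1,\ldots,x_m]$. *)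

theory Defs
  imports
    "HOL-Analysis.Determinants"
    "HOL-Library.Poly_Mapping"
    "HOL-Computational_Algebra.Polynomial_Factorial"
begin

text \<open>
  \<open>\<complex>[x\<^sub>1, \<dots>, x\<^sub>m]\<close> is the monoid algebra of the exponent vectors \<open>'m \<Rightarrow>\<^sub>0 nat\<close>, where the
  index type \<open>'m\<close> stands for \<open>{1, \<dots>, m}\<close>, so that \<open>m = CARD('m)\<close>. The order on \<open>'m\<close> serves to
  single out the last index \<open>m\<close> as \<open>Max UNIV\<close>, and also gives the library instance of class
  \<open>idom\<close> that the field of fractions \<open>'m cpoly fract\<close> requires.
\<close>

type_synonym 'm cpoly = "('m \<Rightarrow>\<^sub>0 nat) \<Rightarrow>\<^sub>0 complex"

definition Const :: "complex \<Rightarrow> 'm cpoly" where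
  "Const c = Poly_Mapping.single 0 c"

definition Var :: "'m \<Rightarrow> 'm cpoly" where
  "Var i = Poly_Mapping.single (Poly_Mapping.single i 1) 1"

definition calg_endomorphism :: "('m cpoly \<Rightarrow> 'm cpoly) \<Rightarrow> bool" where
  "calg_endomorphism f \<longleftrightarrow>
     (\<forall>c. f (Const c) = Const c) \<and>
     (\<forall>p q. f (p + q) = f p + f q) \<and>
     (\<forall>p q. f (p * q) = f p * f q)"

definition calg_automorphism :: "('m cpoly \<Rightarrow> 'm cpoly) \<Rightarrow> bool" where
  "calg_automorphism f \<longleftrightarrow> calg_endomorphism f \<and> bij f"

text \<open>
  The truncated subtraction in the exponent is harmless: for a monomial not containing
  \<open>x\<^sub>j\<close> the coefficient is \<open>0\<close>.
\<close>

definition partial_deriv :: "'m \<Rightarrow> 'm cpoly \<Rightarrow> 'm cpoly" where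
  "partial_deriv j p =
     (\<Sum>e\<in>Poly_Mapping.keys p.
        Poly_Mapping.single (e - Poly_Mapping.single j 1)
          (of_nat (Poly_Mapping.lookup e j) * Poly_Mapping.lookup p e))"

definition Jac :: "('m::finite \<Rightarrow> 'm cpoly) \<Rightarrow> 'm cpoly" where
  "Jac r = det (\<chi> i j. partial_deriv j (r i))"

definition is_subfield :: "'a::field set \<Rightarrow> bool" where
  "is_subfield K \<longleftrightarrow>
     0 \<in> K \<and> 1 \<in> K \<and>
     (\<forall>x\<in>K. \<forall>y\<in>K. x + y \<in> K \<and> x * y \<in> K) \<and>
     (\<forall>x\<in>K. - x \<in> K \<and> inverse x \<in> K)"

definition rational_subfield :: "('m::linorder \<Rightarrow> 'm cpoly) \<Rightarrow> 'm cpoly fract set" where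
  "rational_subfield r =
     \<Inter> {K. is_subfield K \<and> range (\<lambda>c. to_fract (Const c)) \<subseteq> K \<and> range (\<lambda>i. to_fract (r i)) \<subseteq> K}"

lemma partial_deriv_single:
  "partial_deriv j (Poly_Mapping.single e c) =
     Poly_Mapping.single (e - Poly_Mapping.single j 1) (of_nat (Poly_Mapping.lookup e j) * c)"
  by (cases "c = 0") (simp_all add: partial_deriv_def)

lemma partial_deriv_Var: "partial_deriv j (Var i) = (if i = j then 1 else 0)"
  by (simp add: Var_def partial_deriv_single lookup_single)

lemma is_subfield_rational_subfield: "is_subfield (rational_subfield r)"
  by (auto simp: is_subfield_def rational_subfield_def)

end

theory Submission
  imports Defs
begin

text \<open>
  Write \<open>R = \<complex>[x\<^sub>1, \<dots>, x\<^sub>m]\<close>, so that \<open>\<complex>[r\<^sub>1, \<dots>, r\<^sub>m]\<close> is the range of \<open>f\<close>. It has to be shown that the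
  range contains every \<open>x\<^sub>j\<close>; injectivity is easy.

  Since the Jacobian matrix is invertible over \<open>R\<close>, the derivations \<open>\<partial>/\<partial>r\<^sub>i\<close> extend from the range
  to derivations \<open>D i\<close> of \<open>R\<close> (\<open>keller_imp_derivation_lifting\<close>). Geometrically \<open>f\<close> is etale, and the
  consequences needed are these: for \<open>p\<close> irreducible and \<open>P\<close> a prime factor of \<open>f p\<close>, only
  the multiples of \<open>p\<close> are mapped to multiples of \<open>P\<close> (\<open>contraction_principal\<close>), and \<open>P\<^sup>2\<close> does not
  divide \<open>f p\<close> (\<open>f_irreducible_squarefree\<close>). So \<open>P\<close> occurs in \<open>f u\<close> with the same multiplicity as \<open>p\<close>
  in \<open>u\<close>. As every irreducible \<open>p\<close> has a nonunit image, an \<open>n\<close>-th root in \<open>R\<close> of an element of the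
  range has to lie in the range, and so does every element of \<open>R\<close> that is a quotient of elements of
  the range (\<open>fraction_power_imp_in_range\<close>). In other words, the radical extensions of
  \<open>\<complex>(r\<^sub>1, \<dots>, r\<^sub>m)\<close> generated by the \<open>a\<^sub>j x\<^sub>j + b\<^sub>j\<close> are trivial, and \<open>x\<^sub>j\<close> is in the range for \<open>j < m\<close>
  (\<open>radical_in_range\<close>).

  For the last variable, \<open>\<partial>\<^sub>m w\<close> is the Jacobian determinant of \<open>x\<^sub>1, \<dots>, x\<^sub>m\<^sub>-\<^sub>1, w\<close>. If \<open>w\<close> is in the range,
  it can be computed with respect to the \<open>r\<^sub>i\<close> up to a constant factor, so \<open>\<partial>\<^sub>m\<close> preserves the
  range (\<open>partial_deriv_in_range\<close>). Some \<open>r\<^sub>i\<close> contains \<open>x\<^sub>m\<close>; differentiating it until it is linear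
  in \<open>x\<^sub>m\<close> exhibits \<open>x\<^sub>m\<close> as a quotient of elements of the range, which therefore contains it
  (\<open>last_variable_in_range\<close>).

  The argument is carried by unique factorisation in \<open>R\<close>, in the form that irreducible elements are
  prime (\<open>irreducible_imp_prime_elem\<close>), and by the elimination lemma behind it
  (\<open>eliminate_variable\<close>).
\<close>

section \<open>Polynomials, partial derivatives and one distinguished variable\<close>

lemma lookup_partial_deriv:
  "Poly_Mapping.lookup (partial_deriv j p) e =
     of_nat (Poly_Mapping.lookup e j + 1) * Poly_Mapping.lookup p (e + Poly_Mapping.single j 1)"
proof -
  have "Poly_Mapping.lookup (partial_deriv j p) e =
      (\<Sum>d\<in>Poly_Mapping.keys p. if d = e + Poly_Mapping.single j 1
        then of_nat (Poly_Mapping.lookup e j + 1) * Poly_Mapping.lookup p (e + Poly_Mapping.single j 1) else 0)"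
    unfolding partial_deriv_def lookup_sum
  proof (rule sum.cong[OF refl])
    fix d assume "d \<in> Poly_Mapping.keys p"
    have "d = e + Poly_Mapping.single j 1"
      if "d - Poly_Mapping.single j 1 = e" "Poly_Mapping.lookup d j > 0"
    proof (rule poly_mapping_eqI)
      fix k
      have "Poly_Mapping.lookup e k = Poly_Mapping.lookup d k - Poly_Mapping.lookup (Poly_Mapping.single j 1) k"
        using that(1) by (metis lookup_minus)
      then show "Poly_Mapping.lookup d k = Poly_Mapping.lookup (e + Poly_Mapping.single j 1) k"
        using that(2) by (auto simp: lookup_add lookup_single when_def)
    qed
    then have eq: "d - Poly_Mapping.single j 1 = e \<and> Poly_Mapping.lookup d j > 0
        \<longleftrightarrow> d = e + Poly_Mapping.single j 1"
      by (metis add_diff_cancel_right' lookup_add lookup_single_eq add_gr_0 zero_less_one)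
    show "Poly_Mapping.lookup (Poly_Mapping.single (d - Poly_Mapping.single j 1)
          (of_nat (Poly_Mapping.lookup d j) * Poly_Mapping.lookup p d)) e =
        (if d = e + Poly_Mapping.single j 1
         then of_nat (Poly_Mapping.lookup e j + 1) * Poly_Mapping.lookup p (e + Poly_Mapping.single j 1) else 0)"
    proof (cases "d = e + Poly_Mapping.single j 1")
      case True
      then show ?thesis by (simp only: if_True refl add_diff_cancel_right' lookup_single_eq lookup_add)
    next
      case False
      then have "Poly_Mapping.lookup d j = 0 \<or> d - Poly_Mapping.single j 1 \<noteq> e" using eq by auto
      then show ?thesis using False by (elim disjE) (simp_all only: lookup_single when_def if_False of_nat_0 mult_zero_left if_cancel)
    qed
  qed
  also have "\<dots> = of_nat (Poly_Mapping.lookup e j + 1) * Poly_Mapping.lookup p (e + Poly_Mapping.single j 1)"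
    by (simp add: sum.delta' in_keys_iff)
  finally show ?thesis .
qed

lemma partial_deriv_add: "partial_deriv j (p + q) = partial_deriv j p + partial_deriv j q"
  by (rule poly_mapping_eqI) (simp only: lookup_partial_deriv lookup_add distrib_left)

lemma partial_deriv_0 [simp]: "partial_deriv j 0 = 0"
  by (simp add: partial_deriv_def)

lemma partial_deriv_sum: "partial_deriv j (sum g A) = (\<Sum>x\<in>A. partial_deriv j (g x))"
  by (induction A rule: infinite_finite_induct) (auto simp: partial_deriv_add)

lemma partial_deriv_Const [simp]: "partial_deriv j (Const c) = 0"
  by (simp add: Const_def partial_deriv_single)

lemma Const_simps [simp]: "Const 0 = 0" "Const 1 = 1"
  "Const (a + b) = Const a + Const b" "Const (a * b) = Const a * Const b"
  by (simp_all add: Const_def single_add mult_single)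

lemma Const_eq_iff [simp]: "Const a = Const b \<longleftrightarrow> a = b"
  by (metis Const_def lookup_single_eq)

lemma Const_eq_0_iff [simp]: "Const a = 0 \<longleftrightarrow> a = 0"
  using Const_eq_iff[of a 0] by simp

text \<open>
  An additive statement about polynomials needs checking on monomials only; Leibniz rules and the
  multiplicativity of \<open>uni\<close> below are bilinear, so for them it reduces to pairs of monomials.
\<close>

lemma monomial_induct [case_names monomial add]:
  fixes p :: "'a \<Rightarrow>\<^sub>0 'b::comm_monoid_add"
  assumes "\<And>e c. P (Poly_Mapping.single e c)" "\<And>p q. P p \<Longrightarrow> P q \<Longrightarrow> P (p + q)"
  shows "P p"
proof (induction p rule: update_induct)
  case const
  show ?case using assms(1)[of _ 0] by simp
next
  case (update f a b)
  have "Poly_Mapping.update a b f = f + Poly_Mapping.single a b"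
    by (rule poly_mapping_eqI)
      (use update in \<open>auto simp: lookup_update lookup_add lookup_single in_keys_iff when_def\<close>)
  then show ?case using assms update by metis
qed

lemma cpoly_induct [case_names Const Var add mult]:
  fixes p :: "'m::linorder cpoly"
  assumes "\<And>c. P (Const c)" "\<And>i. P (Var i)" "\<And>p q. P p \<Longrightarrow> P q \<Longrightarrow> P (p + q)"
    "\<And>p q. P p \<Longrightarrow> P q \<Longrightarrow> P (p * q)"
  shows "P p"
proof (induction p rule: monomial_induct)
  case (monomial e c)
  have "P (Poly_Mapping.single e 1)"
  proof (induction e rule: monomial_induct)
    case (monomial i n)
    show ?case
    proof (induction n)
      case 0
      then show ?case using assms(1)[of 1] by simp
    next
      case (Suc n)
      have "Poly_Mapping.single (Poly_Mapping.single i (Suc n)) (1::complex) =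
          Poly_Mapping.single (Poly_Mapping.single i n) 1 * Var i"
        by (simp add: Var_def mult_single flip: single_add)
      then show ?case using Suc assms by metis
    qed
  next
    case (add d e)
    then show ?case using assms(4) by (metis mult_single mult.right_neutral)
  qed
  moreover have "Poly_Mapping.single e c = Const c * Poly_Mapping.single e 1"
    by (simp add: Const_def mult_single)
  ultimately show ?case using assms by metis
qed (use assms in auto)

lemma single_minus_add:
  fixes d e :: "'m \<Rightarrow>\<^sub>0 nat"
  assumes "Poly_Mapping.lookup d j > 0"
  shows "d + e - Poly_Mapping.single j 1 = (d - Poly_Mapping.single j 1) + e"
  by (rule poly_mapping_eqI)
    (use assms in \<open>auto simp: lookup_add lookup_minus lookup_single when_def\<close>)

lemma partial_deriv_mult:
  fixes p q :: "'m::linorder cpoly"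
  shows "partial_deriv j (p * q) = partial_deriv j p * q + p * partial_deriv j q"
proof (induction p rule: monomial_induct)
  case (monomial d a)
  show ?case
  proof (induction q rule: monomial_induct)
    case (monomial e b)
    have 1: "Poly_Mapping.single (d + e - Poly_Mapping.single j 1)
        (of_nat (Poly_Mapping.lookup d j) * (a * b)) = partial_deriv j (Poly_Mapping.single d a) * Poly_Mapping.single e b"
      by (cases "Poly_Mapping.lookup d j > 0")
        (auto simp: single_minus_add partial_deriv_single mult_single mult.assoc simp del: One_nat_def)
    have 2: "Poly_Mapping.single (d + e - Poly_Mapping.single j 1)
        (of_nat (Poly_Mapping.lookup e j) * (a * b)) = Poly_Mapping.single d a * partial_deriv j (Poly_Mapping.single e b)"
      by (cases "Poly_Mapping.lookup e j > 0")
        (auto simp: single_minus_add[of e j d, unfolded add.commute[of e d]] partial_deriv_single mult_single ac_simps simp del: One_nat_def)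
    have "partial_deriv j (Poly_Mapping.single d a * Poly_Mapping.single e b) =
        Poly_Mapping.single (d + e - Poly_Mapping.single j 1) (of_nat (Poly_Mapping.lookup d j) * (a * b)) +
        Poly_Mapping.single (d + e - Poly_Mapping.single j 1) (of_nat (Poly_Mapping.lookup e j) * (a * b))"
      by (simp only: mult_single partial_deriv_single lookup_add of_nat_add distrib_right single_add)
    then show ?case by (simp only: 1 2)
  qed (simp add: distrib_left partial_deriv_add)
qed (simp add: distrib_right partial_deriv_add)

lemma partial_deriv_minus: "partial_deriv j (- p) = - partial_deriv j (p :: 'm::linorder cpoly)"
  using partial_deriv_add[of j p "-p"] by (simp add: eq_neg_iff_add_eq_0 add.commute)

lemma partial_deriv_diff:
  "partial_deriv j (p - q) = partial_deriv j p - partial_deriv j (q :: 'm::linorder cpoly)"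
  using partial_deriv_add[of j p "-q"] by (simp add: partial_deriv_minus)

lemma partial_deriv_commute:
  "partial_deriv i (partial_deriv j p) = partial_deriv j (partial_deriv i (p :: 'm::linorder cpoly))"
  by (induction p rule: cpoly_induct)
    (auto simp: partial_deriv_Var partial_deriv_add partial_deriv_mult algebra_simps
      simp flip: Const_simps(2))

text \<open>
  Characteristic 0 enters here: a monomial containing \<open>x\<^sub>j\<close> survives differentiation with respect
  to \<open>x\<^sub>j\<close>, and distinct such monomials stay distinct.
\<close>

lemma ex_Const_if_partial_derivs_0:
  assumes "\<And>j. partial_deriv j p = 0"
  shows "\<exists>c. p = Const c"
proof
  show "p = Const (Poly_Mapping.lookup p 0)"
  proof (rule poly_mapping_eqI)
    fix e
    show "Poly_Mapping.lookup p e = Poly_Mapping.lookup (Const (Poly_Mapping.lookup p 0)) e"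
    proof (cases "e = 0")
      case False
      then obtain j where j: "Poly_Mapping.lookup e j > 0"
        by (metis poly_mapping_eqI gr0I lookup_zero)
      have "e = (e - Poly_Mapping.single j 1) + Poly_Mapping.single j 1"
        by (rule poly_mapping_eqI) (use j in \<open>auto simp: lookup_add lookup_minus lookup_single when_def\<close>)
      then have "Poly_Mapping.lookup p e = 0"
        using lookup_partial_deriv[of j p "e - Poly_Mapping.single j 1"] assms[of j]
        by (metis add.commute lookup_zero mult_eq_0_iff of_nat_eq_0_iff add_is_0 one_neq_zero)
      then show ?thesis using False by (simp add: Const_def lookup_single)
    qed (simp add: Const_def)
  qed
qed

text \<open>
  The coefficients of \<open>uni i p\<close> are polynomials in the variables other than \<open>i\<close>. They stay in the
  full ring, so that the same map serves every choice of the distinguished variable.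
\<close>

definition uni :: "'m \<Rightarrow> 'm::linorder cpoly \<Rightarrow> 'm cpoly poly" where
  "uni i p = (\<Sum>e\<in>Poly_Mapping.keys p.
     monom (Poly_Mapping.single (e - Poly_Mapping.single i (Poly_Mapping.lookup e i)) (Poly_Mapping.lookup p e))
       (Poly_Mapping.lookup e i))"

lemma uni_single:
  "uni i (Poly_Mapping.single e c) =
     monom (Poly_Mapping.single (e - Poly_Mapping.single i (Poly_Mapping.lookup e i)) c) (Poly_Mapping.lookup e i)"
  by (cases "c = 0") (simp_all add: uni_def)

lemma uni_add: "uni i (p + q) = uni i p + uni i q"
proof -
  let ?h = "\<lambda>e c. monom (Poly_Mapping.single (e - Poly_Mapping.single i (Poly_Mapping.lookup e i)) c)
       (Poly_Mapping.lookup e i) :: 'a cpoly poly"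
  let ?K = "Poly_Mapping.keys p \<union> Poly_Mapping.keys q"
  have ext: "uni i r = (\<Sum>e\<in>?K. ?h e (Poly_Mapping.lookup r e))"
    if "Poly_Mapping.keys r \<subseteq> ?K" for r
    unfolding uni_def by (rule sum.mono_neutral_left) (use that in \<open>auto simp: in_keys_iff\<close>)
  show ?thesis
    using Poly_Mapping.keys_add[of p q]
    by (subst (1 2 3) ext)
      (auto simp: lookup_add single_add simp flip: sum.distrib add_monom intro!: sum.cong)
qed

lemma uni_mult: "uni i (p * q) = uni i p * uni i q"
proof (induction p rule: monomial_induct)
  case (monomial d a)
  show ?case
  proof (induction q rule: monomial_induct)
    case (monomial e b)
    have "d + e - Poly_Mapping.single i (Poly_Mapping.lookup d i + Poly_Mapping.lookup e i) =
      (d - Poly_Mapping.single i (Poly_Mapping.lookup d i)) +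
      (e - Poly_Mapping.single i (Poly_Mapping.lookup e i))"
      by (rule poly_mapping_eqI) (auto simp: lookup_add lookup_minus lookup_single when_def)
    then show ?case by (simp add: mult_single uni_single mult_monom lookup_add)
  qed (simp add: distrib_left uni_add)
qed (simp add: distrib_right uni_add)

lemma uni_Const [simp]: "uni i (Const c) = [:Const c:]"
  by (simp add: Const_def uni_single monom_0)

lemma uni_0 [simp]: "uni i 0 = 0" and uni_1 [simp]: "uni i 1 = 1"
  using uni_Const[of i 0] uni_Const[of i 1] by (simp_all add: one_pCons)

lemma uni_Var: "uni i (Var k) = (if k = i then [:0, 1:] else [:Var k:])"
  by (auto simp: Var_def uni_single monom_0 monom_Suc lookup_single one_pCons simp flip: single_one
    intro: arg_cong[where f = "\<lambda>e. Poly_Mapping.single e _"])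

lemma uni_minus: "uni i (- p) = - uni i p"
  using uni_add[of i p "-p"] by (simp add: eq_neg_iff_add_eq_0 add.commute)

lemma uni_diff: "uni i (p - q) = uni i p - uni i q"
  using uni_add[of i p "-q"] by (simp add: uni_minus)

lemma poly_uni_Var: "poly (uni i p) (Var i) = p"
  by (induction p rule: cpoly_induct) (auto simp: uni_add uni_mult uni_Var)

lemma uni_eq_iff [simp]: "uni i p = uni i q \<longleftrightarrow> p = q"
  by (metis poly_uni_Var)

lemma uni_eq_0_iff [simp]: "uni i p = 0 \<longleftrightarrow> p = 0"
  using uni_eq_iff[of i p 0] by simp

lemma uni_partial_deriv: "uni i (partial_deriv i p) = pderiv (uni i p)"
  by (induction p rule: cpoly_induct)
    (auto simp: uni_add uni_mult uni_Var partial_deriv_add partial_deriv_mult partial_deriv_Var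
      pderiv_add pderiv_mult pderiv_pCons one_pCons)

text \<open>
  Differentiation with respect to another variable acts on the coefficients. Together with the
  next lemma it shows that the coefficients contain only variables that the polynomial contains.
\<close>

lemma coeff_uni_partial_deriv:
  assumes "j \<noteq> i"
  shows "coeff (uni i (partial_deriv j p)) n = partial_deriv j (coeff (uni i p) n)"
  using assms
  by (induction p arbitrary: n rule: cpoly_induct)
    (auto simp: uni_add uni_mult uni_Var partial_deriv_add partial_deriv_mult partial_deriv_Var
      coeff_mult partial_deriv_sum sum.distrib coeff_pCons simp flip: Const_simps(2) split: nat.splits)

lemma partial_deriv_coeff_uni [simp]: "partial_deriv i (coeff (uni i p) n) = 0"
  by (induction p arbitrary: n rule: cpoly_induct)
    (auto simp: uni_add uni_mult uni_Var partial_deriv_add partial_deriv_mult partial_deriv_Var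
      coeff_mult partial_deriv_sum coeff_pCons simp flip: Const_simps(2) split: nat.splits)

abbreviation deg_in :: "'m \<Rightarrow> 'm::linorder cpoly \<Rightarrow> nat" where
  "deg_in i p \<equiv> degree (uni i p)"

text \<open>
  Being free of a variable is thus a differential condition, which is closed under ring operations by
  inspection, and also a condition on a degree, which passes to factors.
\<close>

lemma deg_in_eq_0_iff: "deg_in i p = 0 \<longleftrightarrow> partial_deriv i p = 0"
  by (metis pderiv_eq_0_iff uni_partial_deriv uni_eq_0_iff)

lemma uni_free: "partial_deriv i p = 0 \<Longrightarrow> uni i p = [:p:]"
proof -
  assume "partial_deriv i p = 0"
  then obtain a where a: "uni i p = [:a:]" using deg_in_eq_0_iff degree_eq_zeroE by blast
  then have "p = a" using poly_uni_Var[of i p] by simp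
  then show ?thesis using a by simp
qed

lemma deg_in_mult: "p \<noteq> 0 \<Longrightarrow> q \<noteq> 0 \<Longrightarrow> deg_in i (p * q) = deg_in i p + deg_in i q"
  by (simp add: uni_mult degree_mult_eq)

lemma deg_in_partial_deriv_le: "deg_in i (partial_deriv j p) \<le> deg_in i p"
  by (cases "j = i")
    (auto simp: uni_partial_deriv degree_pderiv coeff_uni_partial_deriv coeff_eq_0 intro: degree_le)

text \<open>
  The sum of the degrees in the single variables, not the degree of the largest monomial. It is
  additive on products because every summand is, it drops under differentiation, and it vanishes
  on constants only, which is what the inductions below require of a degree.
\<close>

definition tdeg :: "'m::{finite,linorder} cpoly \<Rightarrow> nat" where
  "tdeg p = (\<Sum>i\<in>UNIV. deg_in i p)"

lemma tdeg_mult: "p \<noteq> 0 \<Longrightarrow> q \<noteq> 0 \<Longrightarrow> tdeg (p * q) = tdeg p + tdeg q"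
  by (simp add: tdeg_def deg_in_mult sum.distrib)

lemma tdeg_eq_0_iff: "tdeg p = 0 \<longleftrightarrow> (\<exists>c. p = Const c)"
  using ex_Const_if_partial_derivs_0[of p] by (auto simp: tdeg_def deg_in_eq_0_iff)

lemma tdeg_partial_deriv_less:
  assumes "partial_deriv j p \<noteq> 0"
  shows "tdeg (partial_deriv j p) < tdeg p"
  unfolding tdeg_def
proof (rule sum_strict_mono_ex1)
  have "deg_in j (partial_deriv j p) < deg_in j p"
    using assms deg_in_eq_0_iff[of j p] by (simp add: uni_partial_deriv degree_pderiv)
  then show "\<exists>i\<in>UNIV. deg_in i (partial_deriv j p) < deg_in i p" by blast
qed (auto simp: deg_in_partial_deriv_le)

lemma unit_iff_tdeg: "p dvd 1 \<longleftrightarrow> p \<noteq> 0 \<and> tdeg p = 0"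
proof
  assume "p dvd 1"
  then obtain q where q: "p * q = 1" by (metis dvdE)
  then have "p \<noteq> 0" "q \<noteq> 0" by auto
  then have "tdeg p + tdeg q = tdeg (1 :: 'a cpoly)" using q tdeg_mult by metis
  moreover have "tdeg (1 :: 'a cpoly) = 0" using tdeg_eq_0_iff Const_simps(2) by metis
  ultimately show "p \<noteq> 0 \<and> tdeg p = 0" using \<open>p \<noteq> 0\<close> by simp
next
  assume "p \<noteq> 0 \<and> tdeg p = 0"
  then obtain c where "p = Const c" "c \<noteq> 0" using tdeg_eq_0_iff by fastforce
  then have "p * Const (inverse c) = 1" by (metis Const_simps(2,4) right_inverse)
  then show "p dvd 1" by (metis dvdI)
qed

lemma unit_iff_Const: "p dvd 1 \<longleftrightarrow> (\<exists>c. c \<noteq> 0 \<and> p = Const c)"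
  for p :: "'m::{finite,linorder} cpoly"
  using unit_iff_tdeg[of p] tdeg_eq_0_iff[of p] by auto

lemma ex_irreducible_factor:
  fixes p :: "'m::{finite,linorder} cpoly"
  assumes "p \<noteq> 0" "\<not> p dvd 1"
  shows "\<exists>q. irreducible q \<and> q dvd p"
  using assms
proof (induction "tdeg p" arbitrary: p rule: less_induct)
  case less
  show ?case
  proof (cases "irreducible p")
    case False
    then obtain a b where ab: "p = a * b" "\<not> a dvd 1" "\<not> b dvd 1"
      using less.prems by (auto simp: irreducible_def)
    with less.prems have nz: "a \<noteq> 0" "b \<noteq> 0" by auto
    then have "tdeg a < tdeg p" using ab unit_iff_tdeg[of b] by (simp add: tdeg_mult)
    then show ?thesis using less.hyps[of a] nz ab by (metis dvd_mult2)
  qed auto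
qed

section \<open>Unique factorisation\<close>

text \<open>
  The polynomials in the variables of \<open>T\<close>, described by derivatives so that closure under the
  ring operations is the Leibniz rule.
\<close>

definition polys_in :: "'m set \<Rightarrow> 'm::linorder cpoly set" where
  "polys_in T = {p. \<forall>j. j \<notin> T \<longrightarrow> partial_deriv j p = 0}"

lemma polys_in_ring [simp, intro]:
  "0 \<in> polys_in T" "1 \<in> polys_in T" "Const c \<in> polys_in T"
  "p \<in> polys_in T \<Longrightarrow> q \<in> polys_in T \<Longrightarrow> p + q \<in> polys_in T"
  "p \<in> polys_in T \<Longrightarrow> q \<in> polys_in T \<Longrightarrow> p - q \<in> polys_in T"
  "p \<in> polys_in T \<Longrightarrow> q \<in> polys_in T \<Longrightarrow> p * q \<in> polys_in T"
  by (auto simp: polys_in_def partial_deriv_add partial_deriv_diff partial_deriv_mult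
      simp flip: Const_simps(2))

lemma polys_in_Var_power: "i \<in> T \<Longrightarrow> Var i ^ k \<in> polys_in T"
  by (induction k) (auto simp: polys_in_def partial_deriv_mult partial_deriv_Var simp flip: Const_simps(2))

lemma polys_in_mono: "S \<subseteq> T \<Longrightarrow> p \<in> polys_in S \<Longrightarrow> p \<in> polys_in T"
  by (auto simp: polys_in_def)

lemma polys_in_UNIV [simp]: "polys_in UNIV = UNIV"
  by (auto simp: polys_in_def)

lemma polys_in_Diff: "p \<in> polys_in T \<Longrightarrow> partial_deriv i p = 0 \<Longrightarrow> p \<in> polys_in (T - {i})"
  by (auto simp: polys_in_def)

lemma coeff_uni_in_polys_in: "p \<in> polys_in T \<Longrightarrow> coeff (uni i p) n \<in> polys_in (T - {i})"
  unfolding polys_in_def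
  by safe (metis Diff_iff partial_deriv_coeff_uni coeff_uni_partial_deriv singletonD uni_0 coeff_0)+

lemma polys_in_factor:
  assumes "p * q \<in> polys_in T" "p * q \<noteq> 0"
  shows "p \<in> polys_in T"
proof -
  have "partial_deriv j p = 0" if "j \<notin> T" for j
  proof -
    have "deg_in j p + deg_in j q = 0"
      using assms that deg_in_eq_0_iff[of j "p * q"] by (auto simp: polys_in_def deg_in_mult)
    then show ?thesis by (simp add: deg_in_eq_0_iff)
  qed
  then show ?thesis by (auto simp: polys_in_def)
qed

lemma polys_in_dvd: "p dvd q \<Longrightarrow> q \<in> polys_in T \<Longrightarrow> q \<noteq> 0 \<Longrightarrow> p \<in> polys_in T"
  by (metis dvdE polys_in_factor)

lemma polys_in_unit:
  fixes p :: "'m::{finite,linorder} cpoly"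
  shows "p dvd 1 \<Longrightarrow> p \<in> polys_in T"
  using unit_iff_Const[of p] by auto

text \<open>
  If all irreducible factors of \<open>c\<close> are prime, each of them divides \<open>q\<close> or \<open>d\<close>, and they can be
  cancelled from \<open>c * p = q * d\<close> one by one. This is the form in which Gauss's lemma is applied:
  denominators introduced by dividing over a field of fractions are removed again.
\<close>

lemma cancel_prime_factors:
  fixes c :: "'m::{finite,linorder} cpoly"
  assumes "c \<noteq> 0" "\<And>\<pi>. irreducible \<pi> \<Longrightarrow> \<pi> dvd c \<Longrightarrow> prime_elem \<pi>" "c * p = q * d"
  obtains c1 c2 q' d' where "c = c1 * c2" "q = c1 * q'" "d = c2 * d'" "p = q' * d'"
proof -
  have "\<exists>c1 c2 q' d'. c = c1 * c2 \<and> q = c1 * q' \<and> d = c2 * d' \<and> p = q' * d'"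
    using assms
  proof (induction "tdeg c" arbitrary: c q d rule: less_induct)
    case less
    show ?case
    proof (cases "c dvd 1")
      case True
      then obtain e where e: "1 = c * e" by (rule dvdE)
      have "q = (c * e) * q" by (simp flip: e)
      moreover have "p = (c * p) * e" by (simp add: mult.commute mult.left_commute flip: e)
      ultimately have "c = c * 1" "q = c * (e * q)" "d = 1 * d" "p = (e * q) * d"
        unfolding less.prems(3) by (simp_all only: ac_simps mult_1)
      then show ?thesis by blast
    next
      case False
      then obtain \<pi> where \<pi>: "irreducible \<pi>" "\<pi> dvd c"
        using ex_irreducible_factor less.prems(1) by blast
      then have prime: "prime_elem \<pi>" using less.prems by blast
      from \<pi> obtain c' where c': "c = \<pi> * c'" by (auto elim: dvdE)
      with less.prems have nz: "\<pi> \<noteq> 0" "c' \<noteq> 0" by auto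
      have small: "tdeg c' < tdeg c"
        using \<pi>(1) nz c' unit_iff_tdeg[of \<pi>] by (simp add: tdeg_mult irreducible_def)
      have primes: "\<And>\<rho>. irreducible \<rho> \<Longrightarrow> \<rho> dvd c' \<Longrightarrow> prime_elem \<rho>"
        using less.prems(2) c' by (meson dvd_mult)
      have "\<pi> dvd q * d" using less.prems(3) c' by (metis dvd_triv_left mult.assoc)
      then consider "\<pi> dvd q" | "\<pi> dvd d" using prime prime_elem_dvd_multD by blast
      then show ?thesis
      proof cases
        case 1
        then obtain q0 where q0: "q = \<pi> * q0" by (auto elim: dvdE)
        then have "c' * p = q0 * d" using less.prems(3) c' nz by (simp add: mult.assoc)
        from less.hyps[OF small nz(2) primes this]
        obtain c1 c2 q' d' where "c' = c1 * c2" "q0 = c1 * q'" "d = c2 * d'" "p = q' * d'" by blast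
        then have "c = (\<pi> * c1) * c2" "q = (\<pi> * c1) * q'" using c' q0 by (simp_all add: mult.assoc)
        then show ?thesis using \<open>d = c2 * d'\<close> \<open>p = q' * d'\<close> by blast
      next
        case 2
        then obtain d0 where d0: "d = \<pi> * d0" by (auto elim: dvdE)
        then have "c' * p = q * d0" using less.prems(3) c' nz by (simp add: mult.assoc mult.left_commute)
        from less.hyps[OF small nz(2) primes this]
        obtain c1 c2 q' d' where "c' = c1 * c2" "q = c1 * q'" "d0 = c2 * d'" "p = q' * d'" by blast
        then have "c = c1 * (\<pi> * c2)" "d = (\<pi> * c2) * d'"
          using c' d0 by (simp_all add: mult.assoc mult.left_commute)
        then show ?thesis using \<open>q = c1 * q'\<close> \<open>p = q' * d'\<close> by blast
      qed
    qed
  qed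
  then show ?thesis using that by blast
qed

text \<open>
  An irreducible \<open>p\<close> containing \<open>x\<^sub>i\<close> and a polynomial \<open>g\<close> that it does not divide are coprime over
  the field of fractions of the other variables, so clearing denominators in a Bezout identity
  gives a combination free of \<open>x\<^sub>i\<close> (a resultant would be another one). The proof takes a
  nonzero element \<open>d\<close> of the ideal generated by \<open>p\<close> and \<open>g\<close> of least degree in \<open>x\<^sub>i\<close>. Up to factors
  free of \<open>x\<^sub>i\<close> it divides \<open>p\<close> and \<open>g\<close>; as \<open>p\<close> is irreducible, \<open>d\<close> either is itself free of \<open>x\<^sub>i\<close>
  or is associated to \<open>p\<close> up to such a factor, and then \<open>p\<close> divides \<open>g\<close>.

  Primality is assumed for irreducible elements free of \<open>x\<^sub>i\<close> only, so that the lemma can serve in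
  the induction that proves unique factorisation.
\<close>

lemma eliminate_variable:
  fixes p g :: "'m::{finite,linorder} cpoly"
  assumes p: "irreducible p" "p \<in> polys_in T" and g: "g \<in> polys_in T" "\<not> p dvd g"
    and i: "i \<in> T" "partial_deriv i p \<noteq> 0"
    and primes: "\<And>\<pi>. irreducible \<pi> \<Longrightarrow> \<pi> \<in> polys_in (T - {i}) \<Longrightarrow> prime_elem \<pi>"
  obtains \<alpha> \<beta> where "\<alpha> * p + \<beta> * g \<noteq> 0" "\<alpha> * p + \<beta> * g \<in> polys_in (T - {i})"
proof -
  define I where "I = {\<alpha> * p + \<beta> * g |\<alpha> \<beta>. \<alpha> \<in> polys_in T \<and> \<beta> \<in> polys_in T}"
  have p0: "p \<noteq> 0" using p(1) by auto
  have I_sub: "w \<in> polys_in T" if "w \<in> I" for w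
    using that p g by (auto simp: I_def)
  have I_lin: "u * w - v * w' \<in> I" if "w \<in> I" "w' \<in> I" "u \<in> polys_in T" "v \<in> polys_in T" for u v w w'
  proof -
    from that obtain \<alpha> \<beta> \<alpha>' \<beta>' where *: "w = \<alpha> * p + \<beta> * g" "w' = \<alpha>' * p + \<beta>' * g"
      "\<alpha> \<in> polys_in T" "\<beta> \<in> polys_in T" "\<alpha>' \<in> polys_in T" "\<beta>' \<in> polys_in T"
      by (auto simp: I_def)
    then have "u * w - v * w' = (u * \<alpha> - v * \<alpha>') * p + (u * \<beta> - v * \<beta>') * g"
      by (simp add: algebra_simps)
    then show ?thesis using * that unfolding I_def by blast
  qed
  have "p = 1 * p + 0 * g" "g = 0 * p + 1 * g" by simp_all
  then have pg_I: "p \<in> I" "g \<in> I" unfolding I_def by blast+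
  then obtain d where d: "d \<in> I" "d \<noteq> 0" and
    d_min: "\<And>w. w \<in> I \<Longrightarrow> w \<noteq> 0 \<Longrightarrow> deg_in i d \<le> deg_in i w"
    using p0 ex_has_least_nat[of "\<lambda>w. w \<in> I \<and> w \<noteq> 0" p "deg_in i"] by blast
  have T_mono: "c \<in> polys_in (T - {i}) \<Longrightarrow> c \<in> polys_in T" for c by (erule polys_in_mono[rotated]) auto
  \<comment> \<open>Pseudo-division by \<open>d\<close> leaves no remainder, since \<open>d\<close> has least degree in \<open>x\<^sub>i\<close>.\<close>
  have reduce: "\<exists>c q. c \<noteq> 0 \<and> c \<in> polys_in (T - {i}) \<and> c * w = q * d" if "w \<in> I" for w
    using that
  proof (induction "deg_in i w" arbitrary: w rule: less_induct)
    case less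
    show ?case
    proof (cases "w = 0")
      case True
      then show ?thesis by (intro exI[of _ 1] exI[of _ 0]) auto
    next
      case False
      define a where "a = lead_coeff (uni i w)"
      define b where "b = lead_coeff (uni i d)"
      define k where "k = deg_in i w - deg_in i d"
      define w1 where "w1 = b * w - (a * Var i ^ k) * d"
      have le: "deg_in i d \<le> deg_in i w" using d_min less.prems False by blast
      have ab: "a \<in> polys_in (T - {i})" "b \<in> polys_in (T - {i})"
        unfolding a_def b_def using less.prems d I_sub by (auto intro!: coeff_uni_in_polys_in)
      have b0: "b \<noteq> 0" using d by (simp add: b_def)
      have w1_I: "w1 \<in> I" unfolding w1_def
        using less.prems d ab i by (intro I_lin) (auto simp: T_mono polys_in_Var_power)
      have ab_const: "uni i a = [:a:]" "uni i b = [:b:]"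
        by (auto intro!: uni_free simp: a_def b_def)
      have Var_pow: "uni i (Var i ^ k) = monom 1 k"
        by (induction k) (auto simp: uni_mult uni_Var monom_Suc)
      have uni_w1: "uni i w1 = smult b (uni i w) - smult a (monom 1 k * uni i d)"
        by (simp add: w1_def uni_diff uni_mult ab_const Var_pow mult.assoc)
      have "degree (monom 1 k * uni i d) \<le> deg_in i w"
        using le by (intro order_trans[OF degree_mult_le]) (simp add: degree_monom_eq k_def)
      then have deg: "deg_in i w1 \<le> deg_in i w"
        unfolding uni_w1 by (intro degree_diff_le) (auto intro: order_trans[OF degree_smult_le])
      have "coeff (monom 1 k * uni i d) (deg_in i w) = b"
        using le by (simp add: coeff_monom_mult k_def b_def)
      then have "coeff (uni i w1) (deg_in i w) = 0"
        unfolding uni_w1 by (simp add: a_def mult.commute)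
      with deg consider "w1 = 0" | "deg_in i w1 < deg_in i w"
        using eq_zero_or_degree_less by (metis uni_eq_0_iff)
      then show ?thesis
      proof cases
        case 1
        then show ?thesis using b0 ab by (auto simp: w1_def)
      next
        case 2
        from less.hyps[OF this w1_I] obtain c q where
          cq: "c \<noteq> 0" "c \<in> polys_in (T - {i})" "c * w1 = q * d" by blast
        then have "(c * b) * w = (q + c * (a * Var i ^ k)) * d"
          by (simp add: w1_def algebra_simps)
        then show ?thesis using cq b0 ab polys_in_ring(6)[of c "T - {i}" b] no_zero_divisors[of c b] by blast
      qed
    qed
  qed
  from reduce[OF pg_I(1)] obtain c q where c: "c \<noteq> 0" "c \<in> polys_in (T - {i})" "c * p = q * d"
    by blast
  from reduce[OF pg_I(2)] obtain e r where e: "e \<noteq> 0" "e \<in> polys_in (T - {i})" "e * g = r * d"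
    by blast
  obtain c1 c2 q' d' where c12: "c = c1 * c2" "q = c1 * q'" "d = c2 * d'" "p = q' * d'"
    by (rule cancel_prime_factors[OF c(1) _ c(3)]) (use primes polys_in_dvd c in blast)
  have c2: "c2 \<in> polys_in (T - {i})" using c c12 by (metis polys_in_factor mult.commute)
  have "d \<in> polys_in (T - {i})"
  proof (rule ccontr)
    assume "d \<notin> polys_in (T - {i})"
    then have d'_nonunit: "\<not> d' dvd 1" using c2 c12 polys_in_unit by blast
    then have q': "q' dvd 1" using p(1) c12 irreducibleD by blast
    have "e * g = (r * c2) * d'" using e c12 by (simp add: mult.assoc)
    then obtain e1 e2 r' d'' where e12: "e = e1 * e2" "r * c2 = e1 * r'" "d' = e2 * d''" "g = r' * d''"
      by (rule cancel_prime_factors[OF e(1), rotated]) (use primes polys_in_dvd e in blast)+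
    have e2: "e2 \<in> polys_in (T - {i})" using e e12 by (metis polys_in_factor mult.commute)
    have "p = (q' * e2) * d''" using c12 e12 by (simp add: mult.assoc)
    moreover have "\<not> d'' dvd 1"
    proof
      assume "d'' dvd 1"
      then have "(q' * e2) * d'' \<in> polys_in (T - {i})" using q' e2 polys_in_unit by blast
      then show False using \<open>p = (q' * e2) * d''\<close> i by (simp add: polys_in_def)
    qed
    ultimately have "q' * e2 dvd 1" using p(1) irreducibleD by blast
    then obtain u where u: "1 = (q' * e2) * u" by (rule dvdE)
    have "p * u = ((q' * e2) * u) * d''" using \<open>p = (q' * e2) * d''\<close> by (simp only: ac_simps)
    then have "p * u = 1 * d''" by (simp only: u)
    then have "p dvd g" using e12 by (metis dvd_mult dvd_triv_left mult_1)
    then show False using g by blast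
  qed
  then show ?thesis using that d by (auto simp: I_def)
qed

text \<open>
  A prime stays prime after adjoining a variable: if \<open>p\<close> divides neither \<open>g\<close> nor \<open>h\<close>, consider the
  lowest coefficients of \<open>g\<close> and \<open>h\<close> that \<open>p\<close> does not divide. Their product is, modulo \<open>p\<close>, a
  coefficient of \<open>g * h\<close>.
\<close>

lemma relative_prime_insert:
  fixes p :: "'m::linorder cpoly"
  assumes p: "p \<in> polys_in T" and j: "j \<notin> T"
    and rel: "\<And>g h. g \<in> polys_in T \<Longrightarrow> h \<in> polys_in T \<Longrightarrow> p dvd g * h \<Longrightarrow> p dvd g \<or> p dvd h"
    and gh: "g \<in> polys_in (insert j T)" "h \<in> polys_in (insert j T)" "p dvd g * h"
  shows "p dvd g \<or> p dvd h"
proof (rule ccontr)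
  assume contra: "\<not> (p dvd g \<or> p dvd h)"
  have uni_p: "uni j p = [:p:]" using p j by (intro uni_free) (auto simp: polys_in_def)
  have dvd_iff: "p dvd w \<longleftrightarrow> (\<forall>n. p dvd coeff (uni j w) n)" for w
  proof
    assume "p dvd w"
    then have "[:p:] dvd uni j w" by (metis dvd_def uni_mult uni_p)
    then show "\<forall>n. p dvd coeff (uni j w) n" by (simp add: const_poly_dvd_iff)
  next
    assume "\<forall>n. p dvd coeff (uni j w) n"
    then obtain K where "uni j w = [:p:] * K" by (auto simp: const_poly_dvd_iff[symmetric] elim: dvdE)
    then have "w = p * poly K (Var j)" by (metis poly_uni_Var poly_mult poly_pCons poly_0 mult_zero_right add_0_right)
    then show "p dvd w" by simp
  qed
  have coeff_in: "coeff (uni j w) n \<in> polys_in T" if "w \<in> polys_in (insert j T)" for w n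
    using coeff_uni_in_polys_in[OF that, of j n] j by simp
  define a where "a = (LEAST n. \<not> p dvd coeff (uni j g) n)"
  define b where "b = (LEAST n. \<not> p dvd coeff (uni j h) n)"
  have a: "\<not> p dvd coeff (uni j g) a" "\<And>n. n < a \<Longrightarrow> p dvd coeff (uni j g) n"
    using contra dvd_iff[of g] LeastI_ex[of "\<lambda>n. \<not> p dvd coeff (uni j g) n"] not_less_Least
    unfolding a_def by blast+
  have b: "\<not> p dvd coeff (uni j h) b" "\<And>n. n < b \<Longrightarrow> p dvd coeff (uni j h) n"
    using contra dvd_iff[of h] LeastI_ex[of "\<lambda>n. \<not> p dvd coeff (uni j h) n"] not_less_Least
    unfolding b_def by blast+
  let ?t = "\<lambda>k. coeff (uni j g) k * coeff (uni j h) (a + b - k)"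
  have "p dvd coeff (uni j (g * h)) (a + b)" using gh(3) dvd_iff by blast
  also have "coeff (uni j (g * h)) (a + b) = (\<Sum>k\<in>{..a + b}. ?t k)"
    by (simp add: uni_mult coeff_mult)
  also have "\<dots> = ?t a + (\<Sum>k\<in>{..a + b} - {a}. ?t k)"
    by (rule sum.remove) auto
  finally have "p dvd ?t a + (\<Sum>k\<in>{..a + b} - {a}. ?t k)" .
  moreover have "p dvd (\<Sum>k\<in>{..a + b} - {a}. ?t k)"
  proof (rule dvd_sum)
    fix k assume k: "k \<in> {..a + b} - {a}"
    show "p dvd ?t k"
    proof (cases "k < a")
      case False
      with k have "a + b - k < b" by auto
      then show ?thesis using b(2) by (simp add: dvd_mult)
    qed (use a(2) in auto)
  qed
  ultimately have "p dvd ?t a" using dvd_add_left_iff by blast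
  then have "p dvd coeff (uni j g) a * coeff (uni j h) b" by simp
  then show False using rel coeff_in gh a(1) b(1) by blast
qed

lemma relative_prime_imp_prime_elem:
  fixes p :: "'m::{finite,linorder} cpoly"
  assumes p: "p \<in> polys_in T" "irreducible p"
    and rel: "\<And>g h. g \<in> polys_in T \<Longrightarrow> h \<in> polys_in T \<Longrightarrow> p dvd g * h \<Longrightarrow> p dvd g \<or> p dvd h"
  shows "prime_elem p"
proof -
  have "p dvd g \<or> p dvd h"
    if "finite S" "S \<inter> T = {}" "g \<in> polys_in (S \<union> T)" "h \<in> polys_in (S \<union> T)" "p dvd g * h" for S g h
    using that
  proof (induction S arbitrary: g h rule: finite_induct)
    case empty
    then show ?case using rel by simp
  next
    case (insert j S)
    show ?case
    proof (rule relative_prime_insert[of p "S \<union> T" j])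
      show "p \<in> polys_in (S \<union> T)" using p(1) by (rule polys_in_mono[rotated]) auto
      show "j \<notin> S \<union> T" using insert by auto
      show "\<And>g h. g \<in> polys_in (S \<union> T) \<Longrightarrow> h \<in> polys_in (S \<union> T) \<Longrightarrow> p dvd g * h \<Longrightarrow> p dvd g \<or> p dvd h"
        using insert by blast
    qed (use insert in auto)
  qed
  from this[of "- T"] show ?thesis
    using p(2) by (auto simp: prime_elem_def irreducible_def)
qed

text \<open>
  Induction on the set of variables. If \<open>p\<close> contains the new variable \<open>x\<^sub>i\<close> and divides \<open>g * h\<close> but not
  \<open>g\<close>, then it divides \<open>\<delta> * h\<close> for the combination \<open>\<delta>\<close> of \<open>p\<close> and \<open>g\<close> provided by
  \<open>eliminate_variable\<close>. The prime factors of \<open>\<delta>\<close> are free of \<open>x\<^sub>i\<close>, hence do not divide \<open>p\<close> and can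
  be cancelled.
\<close>

theorem irreducible_imp_prime_elem:
  fixes p :: "'m::{finite,linorder} cpoly"
  assumes "irreducible p"
  shows "prime_elem p"
proof -
  have "prime_elem p" if "finite T" "irreducible p" "p \<in> polys_in T" for T and p :: "'m cpoly"
    using that
  proof (induction T arbitrary: p rule: finite_induct)
    case empty
    then obtain c where "p = Const c" using ex_Const_if_partial_derivs_0[of p] by (auto simp: polys_in_def)
    then show ?case using empty unit_iff_Const[of p] by (cases "c = 0") (auto simp: irreducible_def)
  next
    case (insert i T)
    have T: "insert i T - {i} = T" using insert by auto
    have primes: "\<And>\<pi>. irreducible \<pi> \<Longrightarrow> \<pi> \<in> polys_in (insert i T - {i}) \<Longrightarrow> prime_elem \<pi>"
      using insert.IH T by simp
    show ?case
    proof (cases "partial_deriv i p = 0")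
      case True
      then show ?thesis using primes insert.prems polys_in_Diff by blast
    next
      case False
      show ?thesis
      proof (rule relative_prime_imp_prime_elem)
        fix g h assume gh: "g \<in> polys_in (insert i T)" "h \<in> polys_in (insert i T)" "p dvd g * h"
        have "p dvd h" if ndvd: "\<not> p dvd g"
        proof -
          obtain \<alpha> \<beta> where \<delta>: "\<alpha> * p + \<beta> * g \<noteq> 0" "\<alpha> * p + \<beta> * g \<in> polys_in (insert i T - {i})"
            using eliminate_variable[OF insert.prems gh(1) ndvd insertI1 False primes] by blast
          have "p dvd (\<alpha> * p + \<beta> * g) * h"
            using gh(3) by (simp add: distrib_right mult.assoc)
          then obtain w where "(\<alpha> * p + \<beta> * g) * h = p * w" by (rule dvdE)
          then obtain c1 c2 p' w' where c: "\<alpha> * p + \<beta> * g = c1 * c2" "p = c1 * p'" "h = p' * w'"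
            by (rule cancel_prime_factors[OF \<delta>(1), rotated]) (use primes polys_in_dvd \<delta> in blast)+
          have c1: "c1 \<in> polys_in (insert i T - {i})" using \<delta> c(1) by (metis polys_in_factor)
          \<comment> \<open>Otherwise \<open>p\<close>, like \<open>c1\<close>, would be free of \<open>x\<^sub>i\<close>.\<close>
          have "\<not> p' dvd 1"
          proof
            assume "p' dvd 1"
            then have "p \<in> polys_in (insert i T - {i})" using c c1 polys_in_unit by blast
            then show False using False by (simp add: polys_in_def)
          qed
          then have "c1 dvd 1" using c(2) insert.prems(1) irreducibleD by blast
          then obtain u where u: "1 = c1 * u" by (rule dvdE)
          have "p * u = (c1 * u) * p'" using c(2) by (simp only: ac_simps)
          then have "p * u = 1 * p'" by (simp only: u)
          then show ?thesis using c(3) by (metis dvd_mult2 dvd_triv_left mult_1)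
        qed
        then show "p dvd g \<or> p dvd h" by blast
      qed (use insert.prems in auto)
    qed
  qed
  from this[of UNIV] show ?thesis using assms by simp
qed

section \<open>Endomorphisms along which the partial derivatives extend\<close>

lemma tdeg_dvd_le: "p dvd q \<Longrightarrow> q \<noteq> 0 \<Longrightarrow> tdeg p \<le> tdeg q"
  by (auto elim!: dvdE simp: tdeg_mult)

lemma dvd_if_power_dvd_power:
  fixes a b :: "'m::{finite,linorder} cpoly"
  assumes "a ^ n dvd b ^ n" "n \<ge> 1"
  shows "a dvd b"
  using assms(1)
proof (induction "tdeg a" arbitrary: a b rule: less_induct)
  case less
  consider "a = 0" | "a dvd 1" | "a \<noteq> 0" "\<not> a dvd 1" by blast
  then show ?case
  proof cases
    case 1
    then show ?thesis using less.prems assms(2) by (simp add: power_0_left)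
  next
    case 2
    then show ?thesis by (rule dvd_trans) simp
  next
    case 3
    then obtain P where P: "irreducible P" "P dvd a" using ex_irreducible_factor by blast
    then have prime: "prime_elem P" by (simp add: irreducible_imp_prime_elem)
    have "P dvd a ^ n" using P(2) assms(2) by (metis dvd_power dvd_trans less_eq_Suc_le One_nat_def)
    then have "P dvd b ^ n" using less.prems by (rule dvd_trans)
    then have "P dvd b" using prime prime_elem_dvd_power by blast
    then obtain a1 b1 where ab: "a = P * a1" "b = P * b1" using P(2) by (auto elim!: dvdE)
    then have nz: "P \<noteq> 0" "a1 \<noteq> 0" using 3 by auto
    have "a1 ^ n dvd b1 ^ n" using less.prems nz by (simp add: ab power_mult_distrib)
    moreover have "tdeg a1 < tdeg a"
      using P(1) nz unit_iff_tdeg[of P] by (simp add: ab tdeg_mult irreducible_def)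
    ultimately show ?thesis using less.hyps ab by (simp add: mult_dvd_mono)
  qed
qed

text \<open>
  This is what remains of the Jacobian condition in the next two sections: the derivation
  \<open>\<partial>/\<partial>r\<^sub>i\<close> of \<open>\<complex>[r\<^sub>1, \<dots>, r\<^sub>m]\<close>, which is \<open>\<partial>/\<partial>x\<^sub>i\<close> transported along \<open>f\<close>, is the restriction of a
  derivation \<open>D i\<close> of the whole polynomial ring. Geometrically, the polynomial map belonging to
  \<open>f\<close> is etale.
\<close>

locale derivation_lifting_endomorphism =
  fixes f :: "'m::{finite,linorder} cpoly \<Rightarrow> 'm cpoly"
    and D :: "'m \<Rightarrow> 'm cpoly \<Rightarrow> 'm cpoly"
  assumes f_Const [simp]: "f (Const c) = Const c"
    and f_add: "f (p + q) = f p + f q"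
    and f_mult: "f (p * q) = f p * f q"
    and D_mult: "D i (p * q) = D i p * q + p * D i q"
    and D_f: "D i (f p) = f (partial_deriv i p)"
begin

lemma f_0 [simp]: "f 0 = 0" and f_1 [simp]: "f 1 = 1"
  using f_Const[of 0] f_Const[of 1] by simp_all

lemma f_power: "f (p ^ n) = f p ^ n"
  by (induction n) (simp_all add: f_mult)

lemma f_diff: "f (p - q) = f p - f q"
  using f_add[of "p - q" q] by simp

lemma D_0 [simp]: "D i 0 = 0"
  using D_f[of i 0] by simp

text \<open>
  The kernel is closed under partial derivatives, so a nonzero element of least degree in it
  would be a constant.
\<close>

lemma f_eq_0_iff [simp]: "f p = 0 \<longleftrightarrow> p = 0"
proof
  show "f p = 0 \<Longrightarrow> p = 0"
  proof (induction "tdeg p" arbitrary: p rule: less_induct)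
    case less
    have "partial_deriv i p = 0" for i
    proof (rule ccontr)
      assume nz: "partial_deriv i p \<noteq> 0"
      have "f (partial_deriv i p) = 0" using less.prems D_f[of i p] by simp
      then show False using less.hyps tdeg_partial_deriv_less nz by blast
    qed
    then obtain c where "p = Const c" using ex_Const_if_partial_derivs_0 by blast
    then show ?case using less.prems by simp
  qed
qed simp

lemma inj_f: "f p = f q \<longleftrightarrow> p = q"
  using f_eq_0_iff[of "p - q"] by (simp add: f_diff)

lemma f_unit_iff: "f p dvd 1 \<longleftrightarrow> p dvd 1"
  using inj_f f_Const unit_iff_Const[of p] unit_iff_Const[of "f p"] by metis

lemma ex_prime_over:
  assumes "irreducible p"
  obtains P where "prime_elem P" "P dvd f p"
proof -
  have "f p \<noteq> 0" "\<not> f p dvd 1" using assms by (auto simp: f_unit_iff irreducible_def)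
  then obtain P where "irreducible P" "P dvd f p" using ex_irreducible_factor by blast
  then show ?thesis using that irreducible_imp_prime_elem by blast
qed

text \<open>
  For a prime \<open>P\<close>, the prime ideal \<open>{h. P dvd f h}\<close> is the contraction of \<open>(P)\<close> along \<open>f\<close>. The next
  lemmas show that it is principal, that is, that the etale map does not contract a hypersurface
  to a set of codimension two. This replaces dimension theory by a computation with derivations.
\<close>

context
  fixes P :: "'m cpoly"
  assumes P: "prime_elem P"
begin

text \<open>
  The vector field \<open>\<partial>\<^sub>i p \<cdot> \<partial>\<^sub>j - \<partial>\<^sub>j p \<cdot> \<partial>\<^sub>i\<close> preserves the contraction: write \<open>f p = P * s\<close> and
  \<open>f \<delta> = P * t\<close>; modulo \<open>P\<close>, the derivations \<open>D\<close> differentiate only the factor \<open>P\<close>, and the two terms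
  \<open>s * t * D i P * D j P\<close> cancel. Here \<open>\<partial>\<^sub>i \<delta> = 0\<close>, and primality of \<open>P\<close> removes the factor \<open>\<partial>\<^sub>i p\<close>.
\<close>

lemma contraction_tangent:
  assumes "P dvd f p" "\<not> P dvd f (partial_deriv i p)"
    and "P dvd f \<delta>" "partial_deriv i \<delta> = 0"
  shows "P dvd f (partial_deriv j \<delta>)"
proof -
  obtain s where s: "f p = P * s" using assms by (auto elim: dvdE)
  obtain t where t: "f \<delta> = P * t" using assms by (auto elim: dvdE)
  have 1: "f (partial_deriv i p) = D i P * s + P * D i s" using D_f[of i p] by (simp add: s D_mult)
  have 2: "f (partial_deriv j \<delta>) = D j P * t + P * D j t" using D_f[of j \<delta>] by (simp add: t D_mult)
  have 3: "D i P * t + P * D i t = 0" using D_f[of i \<delta>] assms(4) by (simp add: t D_mult)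
  have "f (partial_deriv i p) * f (partial_deriv j \<delta>) =
      s * D j P * (D i P * t + P * D i t) +
      P * (D i P * s * D j t + D i s * D j P * t + P * D i s * D j t - s * D j P * D i t)"
    unfolding 1 2 by (simp add: algebra_simps)
  then have "P dvd f (partial_deriv i p) * f (partial_deriv j \<delta>)" unfolding 3 by simp
  then show ?thesis using P assms(2) prime_elem_dvd_multD by blast
qed

text \<open>
  If an element of the contraction is free of \<open>x\<^sub>i\<close>, then so are its derivatives, and by the preceding
  lemma they lie in the contraction again. Differentiating a nonzero one until it is constant
  would make \<open>P\<close> a unit.
\<close>

lemma contraction_not_free:
  assumes p: "P dvd f p" "\<not> P dvd f (partial_deriv i p)"
    and "P dvd f \<delta>" "partial_deriv i \<delta> = 0"
  shows "\<delta> = 0"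
  using assms(3,4)
proof (induction "tdeg \<delta>" arbitrary: \<delta> rule: less_induct)
  case less
  have "partial_deriv j \<delta> = 0" for j
  proof (rule ccontr)
    assume nz: "partial_deriv j \<delta> \<noteq> 0"
    have "P dvd f (partial_deriv j \<delta>)" using contraction_tangent[OF p less.prems] .
    moreover have "partial_deriv i (partial_deriv j \<delta>) = 0"
      using less.prems(2) partial_deriv_commute[of i j \<delta>] by simp
    ultimately show False using less.hyps tdeg_partial_deriv_less nz by blast
  qed
  then obtain c where c: "\<delta> = Const c" using ex_Const_if_partial_derivs_0 by blast
  then have "P dvd Const c" using less.prems by simp
  moreover have "\<not> P dvd 1" using P by (simp add: prime_elem_def)
  ultimately have "\<not> Const c dvd (1 :: 'm cpoly)" using dvd_trans by blast
  then have "c = 0" using unit_iff_Const[of "Const c :: 'm cpoly"] by auto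
  then show ?case using c by simp
qed

text \<open>
  The derivatives of an element of least degree have smaller degree, and not all of them vanish. In
  geometric terms, the hypersurface of such an element is smooth at the generic point of the
  contraction.
\<close>

lemma contraction_ex_transversal:
  assumes "P dvd f p" "p \<noteq> 0"
  obtains q i where "P dvd f q" "\<not> P dvd f (partial_deriv i q)"
proof -
  obtain q where q: "P dvd f q" "q \<noteq> 0" "\<And>w. P dvd f w \<Longrightarrow> w \<noteq> 0 \<Longrightarrow> tdeg q \<le> tdeg w"
    using assms ex_has_least_nat[of "\<lambda>w. P dvd f w \<and> w \<noteq> 0" p tdeg] by blast
  have "\<exists>i. partial_deriv i q \<noteq> 0"
  proof (rule ccontr)
    assume "\<not> ?thesis"
    then have "\<And>i. partial_deriv i q = 0" by blast
    then obtain c where c: "q = Const c" using ex_Const_if_partial_derivs_0[of q] by blast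
    then have "q dvd 1" using q(2) unit_iff_Const[of q] by auto
    moreover have "P dvd q" using q(1) c by simp
    ultimately have "P dvd 1" using dvd_trans by blast
    then show False using P by (simp add: prime_elem_def)
  qed
  then obtain i where i: "partial_deriv i q \<noteq> 0" by blast
  then have "\<not> P dvd f (partial_deriv i q)" using q(3) tdeg_partial_deriv_less by (meson not_le)
  then show ?thesis using that q(1) by blast
qed

text \<open>
  Otherwise \<open>eliminate_variable\<close> would yield a nonzero element of the contraction that is free of the
  variable \<open>x\<^sub>i\<close>, against \<open>contraction_not_free\<close>.
\<close>

lemma contraction_principal:
  assumes "irreducible p" "P dvd f p" "P dvd f g"
  shows "p dvd g"
proof (rule ccontr)
  assume ndvd: "\<not> p dvd g"
  have p0: "p \<noteq> 0" using assms(1) by auto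
  obtain q i where q: "P dvd f q" "\<not> P dvd f (partial_deriv i q)"
    using contraction_ex_transversal assms(2) p0 by blast
  have "partial_deriv i p \<noteq> 0" using contraction_not_free[OF q assms(2)] p0 by blast
  then obtain \<alpha> \<beta> where \<delta>: "\<alpha> * p + \<beta> * g \<noteq> 0" "\<alpha> * p + \<beta> * g \<in> polys_in (UNIV - {i})"
    using eliminate_variable[of p UNIV g i] assms(1) ndvd irreducible_imp_prime_elem
    by (metis polys_in_UNIV UNIV_I)
  have "P dvd f (\<alpha> * p + \<beta> * g)" using assms(2,3) by (simp add: f_add f_mult)
  then show False using contraction_not_free[OF q] \<delta> by (auto simp: polys_in_def)
qed

text \<open>
  If \<open>P\<^sup>2\<close> divided \<open>f p\<close>, then \<open>P\<close> would divide all \<open>f (\<partial>\<^sub>i p) = D i (f p)\<close>, and so \<open>p\<close> would divide its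
  own derivatives.
\<close>

lemma f_irreducible_squarefree:
  assumes p: "irreducible p"
  shows "\<not> P * P dvd f p"
proof
  assume "P * P dvd f p"
  then obtain t where "f p = P * P * t" by (rule dvdE)
  then have t: "f p = P * (P * t)" by (simp only: mult.assoc)
  have "partial_deriv i p = 0" for i
  proof (rule ccontr)
    assume nz: "partial_deriv i p \<noteq> 0"
    have "f (partial_deriv i p) = P * (D i P * t) + P * D i (P * t)"
      using D_f[of i p] by (simp add: t D_mult mult.left_commute)
    then have "P dvd f (partial_deriv i p)" by simp
    moreover have "P dvd f p" by (simp add: t)
    ultimately have "p dvd partial_deriv i p" using contraction_principal p by blast
    then have "tdeg p \<le> tdeg (partial_deriv i p)" using nz tdeg_dvd_le by blast
    then show False using tdeg_partial_deriv_less[OF nz] by simp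
  qed
  then obtain c where "p = Const c" using ex_Const_if_partial_derivs_0 by blast
  then show False using p unit_iff_Const[of p] by (auto simp: irreducible_def)
qed

end

text \<open>
  Let \<open>p\<close> be an irreducible factor of \<open>u\<close> and \<open>P\<close> a prime factor of \<open>f p\<close>. The multiplicity of \<open>P\<close>
  in \<open>f u = y\<^sup>n\<close> is a positive multiple of \<open>n\<close>, and it equals that of \<open>p\<close> in \<open>u\<close>, because \<open>P\<close>
  divides \<open>f p\<close> exactly once and divides no \<open>f u'\<close> with \<open>u'\<close> prime to \<open>p\<close>. Hence \<open>p\<^sup>n\<close> divides \<open>u\<close>, and
  \<open>f p\<close> can be split off from \<open>y\<close>.
\<close>

lemma power_eq_imp_in_range:
  assumes "y ^ n = f u" "n \<ge> 1"
  shows "y \<in> range f"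
  using assms(1)
proof (induction "tdeg u" arbitrary: u y rule: less_induct)
  case less
  consider "u = 0" | "u dvd 1" | "u \<noteq> 0" "\<not> u dvd 1" by blast
  then show ?case
  proof cases
    case 1
    then have "y = f 0" using less.prems assms(2) by (auto simp: power_0_left)
    then show ?thesis by blast
  next
    case 2
    then have "f u dvd 1" by (simp add: f_unit_iff)
    moreover have "y dvd f u" using less.prems assms(2) by (metis dvd_power less_eq_Suc_le One_nat_def)
    ultimately have "y dvd 1" by (metis dvd_trans)
    then obtain c where "y = Const c" using unit_iff_Const[of y] by blast
    then have "y = f (Const c)" by simp
    then show ?thesis by blast
  next
    case 3
    then obtain p where p: "irreducible p" "p dvd u" using ex_irreducible_factor by blast
    then have fp0: "f p \<noteq> 0" by auto
    obtain P where P: "prime_elem P" "P dvd f p" using ex_prime_over p(1) by blast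
    then obtain s where s: "f p = P * s" by (auto elim: dvdE)
    have P_s: "\<not> P dvd s" using f_irreducible_squarefree[OF P(1) p(1)] s by (auto simp: mult_dvd_mono)
    have P0: "P \<noteq> 0" using P by (auto simp: prime_elem_def)
    have "f p dvd f u" using p(2) by (auto elim!: dvdE simp: f_mult)
    then have "P dvd y ^ n" using P(2) less.prems by (metis dvd_trans)
    then have "P dvd y" using P(1) prime_elem_dvd_power by blast
    then have "P ^ n dvd f u" using less.prems by (metis dvd_power_same)
    then obtain z where z: "f u = P ^ n * z" by (rule dvdE)
    \<comment> \<open>Each time, one factor \<open>P\<close> of \<open>f u\<close> is left for the cofactor of \<open>p ^ k\<close>, as \<open>P\<close> does not divide \<open>s\<close>.\<close>
    have "p ^ k dvd u" if "k \<le> n" for k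
      using that
    proof (induction k)
      case (Suc k)
      then obtain u' where u': "u = p ^ k * u'" by (auto elim: dvdE)
      have "P ^ k * (s ^ k * f u') = P ^ k * (P * (P ^ (n - Suc k) * z))"
      proof -
        have "P ^ n = P ^ k * (P * P ^ (n - Suc k))"
          using Suc.prems by (simp flip: power_Suc power_add)
        moreover have "f u = P ^ k * (s ^ k * f u')"
          by (simp only: u' f_mult f_power s power_mult_distrib mult.assoc)
        ultimately show ?thesis using z by (simp only: mult.assoc)
      qed
      then have "P dvd s ^ k * f u'" using P0 by simp
      then have "P dvd f u'"
        using P(1) P_s prime_elem_dvd_multD prime_elem_dvd_power by blast
      then have "p dvd u'" using contraction_principal P p(1) by blast
      then show ?case by (simp add: u' mult.commute mult_dvd_mono)
    qed simp
    then obtain u1 where u1: "u = p ^ n * u1" by (auto elim: dvdE)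
    have nz: "p ^ n \<noteq> 0" "u1 \<noteq> 0" using 3 u1 by auto
    have "f p ^ n dvd y ^ n" using less.prems by (simp add: u1 f_mult f_power)
    then have "f p dvd y" using dvd_if_power_dvd_power assms(2) by blast
    then obtain y1 where y1: "y = f p * y1" by (rule dvdE)
    have "y1 ^ n = f u1"
      using less.prems fp0 by (simp add: y1 u1 f_mult f_power power_mult_distrib)
    moreover have "\<not> p ^ n dvd 1"
      using p(1) assms(2) by (metis dvd_power dvd_trans irreducible_def less_eq_Suc_le One_nat_def)
    then have "tdeg (p ^ n) > 0" using nz(1) unit_iff_tdeg[of "p ^ n"] by (simp only: simp_thms)
    then have "tdeg u1 < tdeg u" unfolding u1 tdeg_mult[OF nz] by simp
    ultimately have "y1 \<in> range f" using less.hyps by blast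
    then obtain h where "y1 = f h" by blast
    then have "y = f (p * h)" using y1 by (simp add: f_mult)
    then show ?thesis by blast
  qed
qed

text \<open>
  A prime factor of \<open>f p\<close>, for \<open>p\<close> an irreducible factor of the denominator \<open>v\<close>, divides \<open>f u\<close>; then
  \<open>p\<close> divides \<open>u\<close> and cancels. For \<open>n = 1\<close> this says that a polynomial in \<open>\<complex>(r\<^sub>1, \<dots>, r\<^sub>m)\<close> lies in
  \<open>\<complex>[r\<^sub>1, \<dots>, r\<^sub>m]\<close>.
\<close>

lemma fraction_power_imp_in_range:
  assumes "f v * y ^ n = f u" "v \<noteq> 0" "n \<ge> 1"
  shows "y \<in> range f"
  using assms(1,2)
proof (induction "tdeg v" arbitrary: u v rule: less_induct)
  case less
  show ?case
  proof (cases "v dvd 1")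
    case True
    then obtain e where e: "1 = v * e" by (rule dvdE)
    have "y ^ n = f (v * e) * y ^ n" by (simp flip: e)
    also have "\<dots> = f e * (f v * y ^ n)" by (simp only: f_mult ac_simps)
    also have "\<dots> = f (e * u)" by (simp only: less.prems f_mult)
    finally have "y ^ n = f (e * u)" .
    then show ?thesis using power_eq_imp_in_range assms(3) by blast
  next
    case False
    then obtain p where p: "irreducible p" "p dvd v" using ex_irreducible_factor less.prems by blast
    then have fp0: "f p \<noteq> 0" by auto
    obtain P where P: "prime_elem P" "P dvd f p" using ex_prime_over p(1) by blast
    from p obtain v1 where v1: "v = p * v1" by (auto elim: dvdE)
    have "f u = f p * (f v1 * y ^ n)" using less.prems(1) by (simp add: v1 f_mult mult.assoc)
    then have "f p dvd f u" by simp
    then have "P dvd f u" using P(2) by (metis dvd_trans)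
    then have "p dvd u" using contraction_principal P p(1) by blast
    then obtain u1 where u1: "u = p * u1" by (rule dvdE)
    have "f v1 * y ^ n = f u1" using less.prems fp0 by (simp add: v1 u1 f_mult mult.assoc)
    moreover have "v1 \<noteq> 0" "tdeg v1 < tdeg v"
      using less.prems(2) p(1) unit_iff_tdeg[of p] by (auto simp: v1 tdeg_mult irreducible_def)
    ultimately show ?thesis using less.hyps by blast
  qed
qed

end

section \<open>Keller endomorphisms\<close>

lemma det_replace_row:
  fixes A :: "'a::comm_ring_1^'n^'n"
  shows "det (\<chi> i. if i = k then v else A $ i) =
    (\<Sum>l\<in>UNIV. v $ l * det (\<chi> i. if i = k then axis l 1 else A $ i))"
proof -
  have "det (\<chi> i. if i = k then v else A $ i) =
      det (\<chi> i. if i = k then \<Sum>l\<in>UNIV. v $ l *s axis l 1 else A $ i)"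
    by (simp only: basis_expansion)
  also have "\<dots> = (\<Sum>l\<in>UNIV. det (\<chi> i. if i = k then v $ l *s axis l 1 else A $ i))"
    by (rule det_linear_row_sum) simp
  finally show ?thesis by (simp only: det_row_mul)
qed

lemma det_replace_row_by_row:
  fixes A :: "'a::comm_ring_1^'n^'n"
  shows "det (\<chi> i. if i = k then A $ l else A $ i) = (if l = k then det A else 0)"
proof (cases "l = k")
  case True
  then have "(\<chi> i. if i = k then A $ l else A $ i) = A" by (simp add: vec_eq_iff)
  then show ?thesis using True by simp
next
  case False
  then show ?thesis using det_identical_rows[of k l "\<chi> i. if i = k then A $ l else A $ i"]
    by (simp add: row_def)
qed

text \<open>
  The inverse is the adjugate divided by the determinant; a cofactor is written as the
  determinant in which a row is replaced by a unit vector.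
\<close>

lemma det_unit_imp_right_inverse:
  fixes A :: "'a::comm_ring_1^'n^'n"
  assumes "det A * u = 1"
  obtains M where "A ** M = mat 1"
proof
  let ?M = "(\<chi> k i0. u * det (\<chi> i. if i = i0 then axis k 1 else A $ i)) :: 'a^'n^'n"
  have "(A ** ?M) $ i1 $ i0 = u * det (\<chi> i. if i = i0 then A $ i1 else A $ i)" for i1 i0
    by (subst det_replace_row) (simp add: matrix_matrix_mult_def sum_distrib_left mult.left_commute)
  then show "A ** ?M = mat 1"
    using assms by (simp add: vec_eq_iff det_replace_row_by_row mat_def mult.commute)
qed

lemma det_replace_row_identity:
  fixes v :: "'a::comm_ring_1^'n"
  shows "det (\<chi> i. if i = k then v else mat 1 $ i) = v $ k"
proof -
  have "axis l 1 = (mat 1 :: 'a^'n^'n) $ l" for l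
    by (simp add: vec_eq_iff axis_def mat_def)
  then have "det (\<chi> i. if i = k then v else mat 1 $ i) = (\<Sum>l\<in>UNIV. v $ l * (if l = k then 1 else 0))"
    by (subst det_replace_row) (simp only: det_replace_row_by_row det_I)
  then show ?thesis by (simp add: if_distrib cong: if_cong)
qed

lemma chain_rule:
  fixes f :: "'m::{finite,linorder} cpoly \<Rightarrow> 'm cpoly"
  assumes "calg_endomorphism f"
  shows "partial_deriv k (f p) = (\<Sum>l\<in>UNIV. f (partial_deriv l p) * partial_deriv k (f (Var l)))"
proof -
  have f: "f (Const c) = Const c" "f (p + q) = f p + f q" "f (p * q) = f p * f q" for c p q
    using assms by (auto simp: calg_endomorphism_def)
  have f01: "f 0 = 0" "f 1 = 1" using f(1)[of 0] f(1)[of 1] by simp_all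
  show ?thesis
  proof (induction p rule: cpoly_induct)
    case (Var i)
    have "f (partial_deriv l (Var i)) * partial_deriv k (f (Var l)) =
        (if l = i then partial_deriv k (f (Var i)) else 0)" for l
      by (simp add: partial_deriv_Var f01)
    then show ?case by simp
  next
    case (add p q)
    then show ?case
      by (simp add: f partial_deriv_add distrib_right sum.distrib)
  next
    case (mult p q)
    then show ?case
      by (simp add: f partial_deriv_mult sum.distrib sum_distrib_left algebra_simps)
  qed (simp add: f f01)
qed

text \<open>
  With \<open>M\<close> the inverse Jacobian matrix, which has polynomial entries because the determinant is a
  unit, the chain rule gives \<open>D i = \<Sum>\<^sub>k M\<^sub>k\<^sub>i \<partial>\<^sub>k\<close>.
\<close>

lemma keller_imp_derivation_lifting:
  fixes f :: "'m::{finite,linorder} cpoly \<Rightarrow> 'm cpoly"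
  assumes endo: "calg_endomorphism f"
    and jac: "Jac (\<lambda>i. f (Var i)) = Const c" "c \<noteq> 0"
  obtains M :: "(('m cpoly, 'm) vec, 'm) vec"
  where "derivation_lifting_endomorphism f (\<lambda>i p. \<Sum>k\<in>UNIV. partial_deriv k p * M $ k $ i)"
    and "det M = Const (inverse c)"
proof -
  let ?J = "(\<chi> i j. partial_deriv j (f (Var i))) :: (('m cpoly, 'm) vec, 'm) vec"
  have detJ: "det ?J * Const (inverse c) = 1"
    using jac by (simp add: Jac_def flip: Const_simps(2,4))
  then obtain M where M: "?J ** M = mat 1" by (rule det_unit_imp_right_inverse)
  have "det ?J * det M = 1" by (simp flip: det_mul add: M)
  then have "det ?J * det M = det ?J * Const (inverse c)" using detJ by simp
  moreover have "det ?J \<noteq> 0" using detJ by auto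
  ultimately have "det M = Const (inverse c)" by simp
  moreover have "derivation_lifting_endomorphism f (\<lambda>i p. \<Sum>k\<in>UNIV. partial_deriv k p * M $ k $ i)"
  proof
    fix i p q
    show "(\<Sum>k\<in>UNIV. partial_deriv k (p * q) * M $ k $ i) =
        (\<Sum>k\<in>UNIV. partial_deriv k p * M $ k $ i) * q + p * (\<Sum>k\<in>UNIV. partial_deriv k q * M $ k $ i)"
      by (simp add: partial_deriv_mult sum.distrib sum_distrib_left algebra_simps)
    have J_M: "(\<Sum>k\<in>UNIV. partial_deriv k (f (Var l)) * M $ k $ i) = (if l = i then 1 else 0)" for l
      using M by (simp add: vec_eq_iff matrix_matrix_mult_def mat_def)
    have "(\<Sum>k\<in>UNIV. partial_deriv k (f p) * M $ k $ i) =
        (\<Sum>k\<in>UNIV. \<Sum>l\<in>UNIV. f (partial_deriv l p) * (partial_deriv k (f (Var l)) * M $ k $ i))"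
      by (simp add: chain_rule[OF endo, of _ p] sum_distrib_right mult.assoc)
    also have "\<dots> = (\<Sum>l\<in>UNIV. f (partial_deriv l p) * (\<Sum>k\<in>UNIV. partial_deriv k (f (Var l)) * M $ k $ i))"
      by (subst sum.swap) (simp only: sum_distrib_left)
    also have "\<dots> = f (partial_deriv i p)" by (simp add: J_M if_distrib cong: if_cong)
    finally show "(\<Sum>k\<in>UNIV. partial_deriv k (f p) * M $ k $ i) = f (partial_deriv i p)" .
  qed (use endo in \<open>auto simp: calg_endomorphism_def\<close>)
  ultimately show ?thesis using that by blast
qed

lemma to_fract_power: "to_fract (p ^ n) = to_fract p ^ n"
  by (induction n) simp_all

context derivation_lifting_endomorphism
begin

lemma f_minus: "f (- p) = - f p"
  using f_diff[of 0 p] by simp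

lemma rational_subfield_fraction:
  assumes "x \<in> rational_subfield (\<lambda>i. f (Var i))"
  obtains u v where "v \<noteq> 0" "x = to_fract (f u) / to_fract (f v)"
proof -
  define K where "K = {to_fract (f u) / to_fract (f v) |u v. v \<noteq> 0}"
  have K_I: "x \<in> K" if "x = to_fract (f u) / to_fract (f v)" "v \<noteq> 0" for x u v
    using that by (auto simp: K_def)
  have K_E: "\<exists>u v. x = to_fract (f u) / to_fract (f v) \<and> v \<noteq> 0" if "x \<in> K" for x
    using that by (auto simp: K_def)
  have img: "to_fract (f u) \<in> K" for u by (rule K_I[of _ u 1]) simp_all
  have "is_subfield K"
    unfolding is_subfield_def
  proof (intro conjI ballI)
    show "0 \<in> K" "1 \<in> K" using img[of 0] img[of 1] by simp_all
  next
    fix x y assume "x \<in> K" "y \<in> K"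
    then obtain u v u' v' where x: "x = to_fract (f u) / to_fract (f v)" "v \<noteq> 0"
      and y: "y = to_fract (f u') / to_fract (f v')" "v' \<noteq> 0" using K_E by metis
    show "x + y \<in> K"
      by (rule K_I[of _ "u * v' + u' * v" "v * v'"]) (use x y in \<open>simp_all add: f_add f_mult add_frac_eq\<close>)
    show "x * y \<in> K"
      by (rule K_I[of _ "u * u'" "v * v'"]) (use x y in \<open>simp_all add: f_mult\<close>)
  next
    fix x assume "x \<in> K"
    then obtain u v where x: "x = to_fract (f u) / to_fract (f v)" "v \<noteq> 0" using K_E by metis
    show "- x \<in> K"
      by (rule K_I[of _ "- u" v]) (use x in \<open>simp_all add: f_minus\<close>)
    show "inverse x \<in> K"
    proof (cases "u = 0")
      case True
      then show ?thesis using x img[of 0] by simp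
    next
      case False
      then show ?thesis by (intro K_I[of _ v u]) (use x in simp_all)
    qed
  qed
  moreover have "to_fract (Const c) \<in> K" for c using img[of "Const c"] by simp
  ultimately have "rational_subfield (\<lambda>i. f (Var i)) \<subseteq> K"
    using img unfolding rational_subfield_def by (intro Inter_lower) auto
  then show ?thesis using assms K_E that by blast
qed

text \<open>
  Clearing the denominators of \<open>a\<close> and \<open>b\<close> turns \<open>a x + b\<close> into a polynomial \<open>y\<close>, to which
  \<open>fraction_power_imp_in_range\<close> applies; then \<open>x\<close> is a quotient of elements of the range, and the same
  lemma with exponent 1 applies to it.
\<close>

lemma radical_in_range:
  assumes a: "a \<in> rational_subfield (\<lambda>i. f (Var i))" "a \<noteq> 0"
    and b: "b \<in> rational_subfield (\<lambda>i. f (Var i))"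
    and pow: "(a * to_fract x + b) ^ n \<in> rational_subfield (\<lambda>i. f (Var i))" "n \<ge> 1"
  shows "x \<in> range f"
proof -
  obtain a1 d where a1: "d \<noteq> 0" "a = to_fract (f a1) / to_fract (f d)"
    using a(1) by (rule rational_subfield_fraction)
  obtain b1 e where b1: "e \<noteq> 0" "b = to_fract (f b1) / to_fract (f e)"
    using b by (rule rational_subfield_fraction)
  obtain u v where uv: "v \<noteq> 0" "(a * to_fract x + b) ^ n = to_fract (f u) / to_fract (f v)"
    using pow(1) by (rule rational_subfield_fraction)
  define y where "y = f (a1 * e) * x + f (b1 * d)"
  have "to_fract y = to_fract (f (d * e)) * (a * to_fract x + b)"
    using a1 b1 by (simp add: y_def f_mult field_simps)
  then have "to_fract (f v) * to_fract y ^ n = to_fract (f (d * e)) ^ n * to_fract (f u)"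
    using uv by (simp add: power_mult_distrib)
  then have "to_fract (f v * y ^ n) = to_fract (f ((d * e) ^ n * u))"
    by (simp add: f_mult f_power to_fract_power)
  then have "f v * y ^ n = f ((d * e) ^ n * u)" by (simp only: to_fract_eq_iff)
  then have "y \<in> range f" using uv(1) pow(2) by (rule fraction_power_imp_in_range)
  then obtain h where "y = f h" by blast
  then have "f (a1 * e) * x ^ 1 = f (h - b1 * d)" by (simp add: y_def f_diff eq_diff_eq)
  moreover have "a1 * e \<noteq> 0" using a(2) a1 b1 by auto
  ultimately show ?thesis by (rule fraction_power_imp_in_range) simp
qed

lemma f_sum: "f (sum g A) = (\<Sum>x\<in>A. f (g x))"
  by (induction A rule: infinite_finite_induct) (auto simp: f_add)

lemma f_prod: "f (prod g A) = (\<Prod>x\<in>A. f (g x))"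
  by (induction A rule: infinite_finite_induct) (auto simp: f_mult)

lemma f_of_int: "f (of_int z) = of_int z"
proof -
  have "(of_int z :: 'm cpoly) = Const (of_int z)" by (simp add: Const_def)
  then show ?thesis by simp
qed

lemma f_det: "f (det A) = det (\<chi> i j. f (A $ i $ j))"
  by (simp add: det_def f_sum f_mult f_of_int f_prod)

text \<open>
  The coefficient at \<open>x\<^sub>m\<^sup>0\<close> is multiplicative, which allows the induction over all polynomials rather
  than over those free of \<open>x\<^sub>m\<close>.
\<close>

lemma free_in_range:
  assumes vars: "\<And>j. j \<noteq> m \<Longrightarrow> Var j \<in> range f" and p: "partial_deriv m p = 0"
  shows "p \<in> range f"
proof -
  have "coeff (uni m q) 0 \<in> range f" for q
  proof (induction q rule: cpoly_induct)
    case (Const c)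
    then show ?case using f_Const[of c] by (metis uni_Const coeff_pCons_0 rangeI)
  next
    case (Var j)
    then show ?case using vars[of j] f_0 by (auto simp: uni_Var intro: rev_image_eqI[of 0])
  next
    case (add p q)
    then show ?case by (auto simp: uni_add simp flip: f_add)
  next
    case (mult p q)
    then show ?case by (auto simp: uni_mult coeff_mult simp flip: f_mult)
  qed
  from this[of p] show ?thesis using uni_free[OF p] by simp
qed

text \<open>
  Let \<open>x\<^sub>j = f g\<^sub>j\<close> for \<open>j \<noteq> m\<close> and \<open>w = f p\<close>. The Jacobian determinant of the \<open>x\<^sub>j\<close> and \<open>w\<close> is \<open>\<partial>\<^sub>m w\<close>. On
  the other hand it is, up to the constant \<open>det M\<close>, the image under \<open>f\<close> of the Jacobian determinant of
  the \<open>g\<^sub>j\<close> and \<open>p\<close>.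
\<close>

lemma partial_deriv_in_range:
  fixes M :: "(('m cpoly, 'm) vec, 'm) vec"
  assumes D_eq: "\<And>i p. D i p = (\<Sum>k\<in>UNIV. partial_deriv k p * M $ k $ i)"
    and M: "det M = Const u" "u \<noteq> 0"
    and vars: "\<And>j. j \<noteq> m \<Longrightarrow> Var j \<in> range f" and w: "w \<in> range f"
  shows "partial_deriv m w \<in> range f"
proof -
  define z where "z j = (if j = m then w else Var j)" for j
  have "\<forall>j. \<exists>g. z j = f g" using vars w by (auto simp: z_def)
  then obtain g where g: "\<And>j. z j = f (g j)" by metis
  define B where "B = (\<chi> j k. partial_deriv k (z j))"
  have "B = (\<chi> j. if j = m then (\<chi> k. partial_deriv k w) else mat 1 $ j)"
    by (simp add: B_def z_def vec_eq_iff mat_def partial_deriv_Var)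
  then have detB: "det B = partial_deriv m w" by (simp add: det_replace_row_identity)
  have "f (partial_deriv i (g j)) = (B ** M) $ j $ i" for i j
    by (simp add: D_f[symmetric] g[symmetric] D_eq B_def matrix_matrix_mult_def)
  then have "f (det (\<chi> j i. partial_deriv i (g j))) = det (B ** M)"
    unfolding f_det by (intro arg_cong[of _ _ det]) (simp add: vec_eq_iff)
  also have "\<dots> = partial_deriv m w * Const u" by (simp add: det_mul detB M)
  finally have "f (det (\<chi> j i. partial_deriv i (g j)) * Const (inverse u)) = partial_deriv m w"
    using M by (simp add: f_mult mult.assoc flip: Const_simps(4))
  then show ?thesis by (metis rangeI)
qed

text \<open>
  Differentiating \<open>w\<close> repeatedly with respect to \<open>x\<^sub>m\<close> stays in the range of \<open>f\<close> and ends with a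
  polynomial \<open>\<gamma> + \<beta> x\<^sub>m\<close> with \<open>\<beta> \<noteq> 0\<close>, where \<open>\<beta>\<close> and \<open>\<gamma>\<close> are free of \<open>x\<^sub>m\<close> and so lie in the range too.
  Hence \<open>x\<^sub>m\<close> is a quotient of elements of the range.
\<close>

lemma last_variable_in_range:
  fixes M :: "(('m cpoly, 'm) vec, 'm) vec"
  assumes D_eq: "\<And>i p. D i p = (\<Sum>k\<in>UNIV. partial_deriv k p * M $ k $ i)"
    and M: "det M = Const u" "u \<noteq> 0"
    and vars: "\<And>j. j \<noteq> m \<Longrightarrow> Var j \<in> range f"
    and w: "w \<in> range f" "partial_deriv m w \<noteq> 0"
  shows "Var m \<in> range f"
  using w
proof (induction "deg_in m w" arbitrary: w rule: less_induct)
  case less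
  let ?w' = "partial_deriv m w"
  have deg: "deg_in m w > 0" "deg_in m ?w' = deg_in m w - 1"
    using less.prems(2) deg_in_eq_0_iff[of m w] by (simp_all add: uni_partial_deriv degree_pderiv)
  show ?case
  proof (cases "partial_deriv m ?w' = 0")
    case False
    have "?w' \<in> range f" by (rule partial_deriv_in_range[OF D_eq M vars less.prems(1)])
    then show ?thesis using less.hyps[of ?w'] False deg by simp
  next
    case True
    then have "deg_in m w = 1" using deg deg_in_eq_0_iff[of m ?w'] by simp
    then obtain \<gamma> \<beta> where uni_w: "uni m w = [:\<gamma>, \<beta>:]" "\<beta> \<noteq> 0"
      by (metis degree1_coeffs One_nat_def)
    then have "\<gamma> = coeff (uni m w) 0" "\<beta> = coeff (uni m w) 1" by simp_all
    then have "partial_deriv m \<gamma> = 0" "partial_deriv m \<beta> = 0" by (simp_all only: partial_deriv_coeff_uni)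
    then have "\<gamma> \<in> range f" "\<beta> \<in> range f" using free_in_range vars by blast+
    then obtain h b q where h: "\<gamma> = f h" "\<beta> = f b" "w = f q" using less.prems(1) by blast
    have "w = \<gamma> + Var m * \<beta>" using poly_uni_Var[of m w] uni_w by simp
    then have "f b * Var m ^ 1 = f (q - h)" using h by (simp add: f_diff algebra_simps)
    moreover have "b \<noteq> 0" using uni_w(2) h by auto
    ultimately show ?thesis by (rule fraction_power_imp_in_range) simp
  qed
qed

end

lemma Jac_nonzero_imp_column_nonzero:
  fixes r :: "'m::{finite,linorder} \<Rightarrow> 'm cpoly"
  assumes "Jac r \<noteq> 0"
  obtains i where "partial_deriv j (r i) \<noteq> 0"
proof -
  let ?J = "(\<chi> i k. partial_deriv k (r i)) :: (('m cpoly, 'm) vec, 'm) vec"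
  have "\<exists>i. partial_deriv j (r i) \<noteq> 0"
  proof (rule ccontr)
    assume "\<not> ?thesis"
    then have "row j (transpose ?J) = 0" by (simp add: row_def transpose_def vec_eq_iff)
    then have "det (transpose ?J) = 0" by (rule det_zero_row(1))
    then show False using assms by (simp add: det_transpose Jac_def)
  qed
  then show ?thesis using that by blast
qed

section \<open>Radical variables force invertibility\<close>

theorem theorem3p2:
  fixes f :: "'m::{finite,linorder} cpoly \<Rightarrow> 'm cpoly"
    and r :: "'m \<Rightarrow> 'm cpoly"
    and n :: "'m \<Rightarrow> nat"
    and a b :: "'m \<Rightarrow> 'm cpoly fract"
  assumes m_ge_2: "CARD('m) \<ge> 2"
    and endo: "calg_endomorphism f"
    and r_def: "\<And>i. r i = f (Var i)"
    and jac: "\<exists>c. c \<noteq> 0 \<and> Jac r = Const c"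
    and n_pos: "\<And>j. j < Max UNIV \<Longrightarrow> n j \<ge> 1"
    and a_in: "\<And>j. j < Max UNIV \<Longrightarrow> a j \<in> rational_subfield r - {0}"
    and b_in: "\<And>j. j < Max UNIV \<Longrightarrow> b j \<in> rational_subfield r"
    and power_in: "\<And>j. j < Max UNIV \<Longrightarrow>
      (a j * to_fract (Var j) + b j) ^ n j \<in> rational_subfield r"
  shows "calg_automorphism f"
proof -
  have r: "r = (\<lambda>i. f (Var i))" using r_def by blast
  obtain c where c: "c \<noteq> 0" "Jac r = Const c" using jac by blast
  obtain M where lift: "derivation_lifting_endomorphism f (\<lambda>i p. \<Sum>k\<in>UNIV. partial_deriv k p * M $ k $ i)"
    and M: "det M = Const (inverse c)"
    by (rule keller_imp_derivation_lifting[OF endo]) (use c r in auto)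
  interpret derivation_lifting_endomorphism f "\<lambda>i p. \<Sum>k\<in>UNIV. partial_deriv k p * M $ k $ i"
    by (rule lift)
  have vars: "Var j \<in> range f" if "j \<noteq> Max UNIV" for j
  proof -
    have "j < Max UNIV" using that Max_ge[of UNIV j] by (simp add: order_less_le)
    then show ?thesis
      using radical_in_range[of "a j" "b j" "Var j" "n j"] a_in b_in power_in n_pos r by auto
  qed
  obtain i where "partial_deriv (Max UNIV) (r i) \<noteq> 0"
    using Jac_nonzero_imp_column_nonzero[of r] c by auto
  then have "Var (Max UNIV) \<in> range f"
    using last_variable_in_range[OF refl M _ vars, where w = "r i"] c r by auto
  then have vars': "Var j \<in> range f" for j using vars by (cases "j = Max UNIV") auto
  have "p \<in> range f" for p
  proof (induction p rule: cpoly_induct)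
    case (Const c)
    then show ?case using f_Const[of c] by (metis rangeI)
  next
    case (add p q)
    then show ?case by (auto simp flip: f_add)
  next
    case (mult p q)
    then show ?case by (auto simp flip: f_mult)
  qed (rule vars')
  then have "surj f" by blast
  moreover have "inj f" by (rule injI) (simp add: inj_f)
  ultimately show ?thesis using endo by (simp add: calg_automorphism_def bij_def)
qed

end
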